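(* Let $d\ge1$ be an integer, let $0\le s_j<1$ for $1\le j\le d$, and let $\pi(\beta)=\prod_{j=1}^d2^{s_jd_T(\beta_j)}$, $\beta\in T^d$, be a standard polynomial weight. There exists a constant $C>1$ depending only on $d$ and $\pi$ such that for every compact set $E\subset\overline{T}^d$, with boundary projection $$\mathcal{S}_b(E)=\bigcup_{\beta\in E}\partial\mathcal{S}(\beta)\subset(\partial T)^d,$$ one has $$\mathrm{Cap}_\pi\,\mathcal{S}_b(E)\le\mathrm{Cap}_\pi E\le C\,\mathrm{Cap}_\pi\,\mathcal{S}_b(E).$$
   Context: $T$ denotes the (vertex set of the) rooted infinite binary tree with root $o$, in which every vertex has exactly two children. $\partial T$ is the set of infinite descending paths starting at $o$, and $\overline{T}=T\cup\partial T$. For $\alpha,\beta\in T$ write $\alpha\le\beta$ if $\beta$ lies on the geodesic from $o$ to $\alpha$ (so $o$ is the largest element); for $\omega\in\partial T$, $\omega\le\alpha$ means that $\alpha$ is a vertex on the path $\omega$, or $\alpha=\omega$. For $\alpha,\beta\in\overline{T}$, $\alpha\wedge\beta$ is their least common ancestor (with $\alpha\wedge\alpha=\alpha$), and $d_T(\alpha)$ is the number of vertices $\gamma\in T$ with $\gamma\ge\alpha$ (so $d_T(o)=1$, and $d_T(\omega)=\infty$ for $\omega\in\partial T$). $T^d$, $(\partial T)^d$ and $\overline{T}^d$ are the $d$-fold Cartesian products of $T$, $\partial T$ and $\overline{T}$, with the coordinatewise order. For $\beta\in\overline{T}^d$, $\mathcal{S}(\beta)=\{\alpha\in\overline{T}^d:\alpha\le\beta\}$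 and $\partial\mathcal{S}(\beta)=\mathcal{S}(\beta)\cap(\partial T)^d$. $\overline{T}^d$ carries the topology of the metric $\delta(\alpha,\beta)=\sum_{j=1}^d\big(2^{-d_T(\alpha_j\wedge\beta_j)}-\tfrac12(2^{-d_T(\alpha_j)}+2^{-d_T(\beta_j)})\big)$, where $2^{-\infty}=0$. For $f:T^d\to[0,\infty)$ put $(\mathbb{I}f)(\alpha)=\sum_{\gamma\in T^d,\gamma\ge\alpha}f(\gamma)\pi(\gamma)$, $\alpha\in\overline{T}^d$. The capacity of $E\subset\overline{T}^d$ is $$\mathrm{Cap}_\pi E=\inf\Big\{\sum_{\alpha\in T^d}f(\alpha)^2\pi(\alpha):\ f\ge0,\ (\mathbb{I}f)(\alpha)\ge1\ \text{for all }\alpha\in E\Big\}.$$ *)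

theory Defs
  imports "HOL-Analysis.Analysis" "HOL-Library.Extended_Nat" "HOL-Library.Sublist"
begin

text \<open>
  A vertex of the binary tree is the word of left/right turns leading to it from the root; a
  boundary point is an infinite such sequence.  The type \<open>tbar\<close> is the closed tree.
\<close>

datatype tbar = Vertex "bool list" | Ray "nat \<Rightarrow> bool"

definition tree :: "tbar set" where
  "tree = range Vertex"

definition bdry :: "tbar set" where
  "bdry = range Ray"

text \<open>
  The root is the largest element, so that the least common ancestor, written with a meet symbol in
  the literature, is the binary supremum of this order.  The order on \<open>'d \<Rightarrow> tbar\<close> is the library's
  pointwise one.
\<close>

instantiation tbar :: order
begin

fun less_eq_tbar :: "tbar \<Rightarrow> tbar \<Rightarrow> bool" where
  "Vertex a \<le> Vertex b \<longleftrightarrow> prefix b a"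
| "Ray w \<le> Vertex b \<longleftrightarrow> (\<exists>n. b = map w [0..<n])"
| "Ray w \<le> Ray v \<longleftrightarrow> w = v"
| "Vertex a \<le> Ray v \<longleftrightarrow> False"

definition less_tbar :: "tbar \<Rightarrow> tbar \<Rightarrow> bool" where
  "x < y \<longleftrightarrow> x \<le> y \<and> \<not> y \<le> (x::tbar)"

lemma prefix_map_upt: "prefix b (map w [0..<n]) \<Longrightarrow> b = map w [0..<length b]"
proof -
  assume p: "prefix b (map w [0..<n])"
  then have "length b \<le> n" using prefix_length_le by fastforce
  moreover have "b = take (length b) (map w [0..<n])"
    using p by (auto simp: prefix_def)
  ultimately show ?thesis by (metis add_0 take_map take_upt)
qed

instance
proof
  fix x y z :: tbar
  show "x < y \<longleftrightarrow> x \<le> y \<and> \<not> y \<le> x"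
    by (rule less_tbar_def)
  show "x \<le> x"
    by (cases x) auto
  show "x \<le> z" if "x \<le> y" "y \<le> z"
    using that by (cases x; cases y; cases z) (auto dest: prefix_map_upt)
  show "x = y" if "x \<le> y" "y \<le> x"
    using that by (cases x; cases y) auto
qed

end

lemma ancestors_chain:
  fixes x y z :: tbar
  assumes "x \<le> y" "x \<le> z"
  shows "y \<le> z \<or> z \<le> y"
proof (cases x)
  case (Vertex a)
  then show ?thesis
    using assms by (cases y; cases z) (auto dest: prefix_same_cases)
next
  case (Ray w)
  have *: "prefix (map w [0..<m]) (map w [0..<n])" if "m \<le> n" for m n
  proof -
    have "map w [0..<m] = take m (map w [0..<n])" using that by (simp add: take_map)
    then show ?thesis by (metis take_is_prefix)
  qed
  show ?thesis
    using assms Ray by (cases y; cases z) (auto, metis * nat_le_linear)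
qed

lemma lca_exists:
  fixes x y :: tbar
  shows "\<exists>z. x \<le> z \<and> y \<le> z \<and> (\<forall>u. x \<le> u \<and> y \<le> u \<longrightarrow> z \<le> u)"
proof (cases "x = y")
  case True
  then show ?thesis by blast
next
  case False
  let ?P = "\<lambda>b. x \<le> Vertex b \<and> y \<le> Vertex b"
  have "\<exists>N. \<forall>b. ?P b \<longrightarrow> length b \<le> N"
  proof (cases x; cases y)
    fix w v assume xy: "x = Ray w" "y = Ray v"
    then obtain i where i: "w i \<noteq> v i" using False by auto
    have "length b \<le> i" if "?P b" for b
    proof (rule ccontr)
      assume "\<not> length b \<le> i"
      moreover obtain m n where "b = map w [0..<m]" "b = map v [0..<n]"
        using \<open>?P b\<close> xy by (metis less_eq_tbar.simps(2))
      ultimately have "b ! i = w i" "b ! i = v i"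
        by (metis add_0 diff_zero length_map length_upt not_le nth_map nth_upt)+
      with i show False by simp
    qed
    then show ?thesis by blast
  qed (auto dest: prefix_length_le)
  then obtain N where N: "\<And>b. ?P b \<Longrightarrow> length b \<le> N" by blast
  have "x \<le> Vertex []" "y \<le> Vertex []" by (cases x; simp) (cases y; simp)
  then obtain b where b: "?P b" "\<And>c. ?P c \<Longrightarrow> length c \<le> length b"
    using ex_has_greatest_nat[of ?P "[]" length "Suc N"] N by (auto simp: less_Suc_eq_le)
  have "Vertex b \<le> u" if u: "x \<le> u" "y \<le> u" for u
  proof (cases u)
    case (Vertex c)
    then have "length c \<le> length b" using b u by blast
    moreover have "prefix c b \<or> prefix b c"
      using ancestors_chain[of x "Vertex b" u] b u Vertex by auto
    ultimately show ?thesis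
      using Vertex by (auto simp: prefix_def)
  next
    case (Ray v)
    then have "x = u" "y = u" using u by (cases x; cases y; auto)+
    then show ?thesis using False by simp
  qed
  then show ?thesis using b by blast
qed

instantiation tbar :: semilattice_sup
begin

definition sup_tbar :: "tbar \<Rightarrow> tbar \<Rightarrow> tbar" where
  "sup_tbar x y = (LEAST z. x \<le> z \<and> y \<le> z)"

instance
proof
  fix x y z :: tbar
  obtain u where u: "x \<le> u" "y \<le> u" "\<And>v. x \<le> v \<and> y \<le> v \<Longrightarrow> u \<le> v"
    using lca_exists by blast
  have [simp]: "sup x y = u"
    unfolding sup_tbar_def by (rule Least_equality) (use u in auto)
  show "x \<le> sup x y" "y \<le> sup x y"
    using u by auto
next
  fix x y z :: tbar
  assume "y \<le> x" "z \<le> x"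
  moreover obtain u where u: "y \<le> u" "z \<le> u" "\<And>v. y \<le> v \<and> z \<le> v \<Longrightarrow> u \<le> v"
    using lca_exists by blast
  moreover have "sup y z = u"
    unfolding sup_tbar_def by (rule Least_equality) (use u in auto)
  ultimately show "sup y z \<le> x" by blast
qed

end

definition depth :: "tbar \<Rightarrow> enat" where
  "depth \<alpha> = (if finite {\<gamma> \<in> tree. \<alpha> \<le> \<gamma>} then enat (card {\<gamma> \<in> tree. \<alpha> \<le> \<gamma>}) else \<infinity>)"

definition two_pow_minus :: "enat \<Rightarrow> real" where
  "two_pow_minus n = (case n of enat k \<Rightarrow> (1/2) ^ k | \<infinity> \<Rightarrow> 0)"

text \<open>
  The dimension is the cardinality of the finite index type \<open>'d\<close>; points of the \<open>d\<close>-fold product of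
  the closed tree are functions \<open>'d \<Rightarrow> tbar\<close>.
\<close>

definition polytree :: "('d::finite \<Rightarrow> tbar) set" where
  "polytree = {\<alpha>. \<forall>j. \<alpha> j \<in> tree}"

definition polybdry :: "('d::finite \<Rightarrow> tbar) set" where
  "polybdry = {\<alpha>. \<forall>j. \<alpha> j \<in> bdry}"

definition succs :: "('d::finite \<Rightarrow> tbar) \<Rightarrow> ('d \<Rightarrow> tbar) set" where
  "succs \<beta> = {\<alpha>. \<alpha> \<le> \<beta>}"

definition bdry_succs :: "('d::finite \<Rightarrow> tbar) \<Rightarrow> ('d \<Rightarrow> tbar) set" where
  "bdry_succs \<beta> = succs \<beta> \<inter> polybdry"

definition bdry_proj :: "('d::finite \<Rightarrow> tbar) set \<Rightarrow> ('d \<Rightarrow> tbar) set" where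
  "bdry_proj E = (\<Union>\<beta>\<in>E. bdry_succs \<beta>)"

definition delta :: "('d::finite \<Rightarrow> tbar) \<Rightarrow> ('d \<Rightarrow> tbar) \<Rightarrow> real" where
  "delta \<alpha> \<beta> = (\<Sum>j\<in>UNIV. two_pow_minus (depth (sup (\<alpha> j) (\<beta> j)))
     - 1/2 * (two_pow_minus (depth (\<alpha> j)) + two_pow_minus (depth (\<beta> j))))"

lemma infinite_ancestors_Ray: "infinite {\<gamma> \<in> tree. Ray w \<le> \<gamma>}"
proof -
  have "inj (\<lambda>n. Vertex (map w [0..<n]))"
  proof (rule injI)
    fix m n assume "Vertex (map w [0..<m]) = Vertex (map w [0..<n])"
    then have "length (map w [0..<m]) = length (map w [0..<n])" by simp
    then show "m = n" by simp
  qed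
  then have "infinite (range (\<lambda>n. Vertex (map w [0..<n])))"
    using finite_imageD by blast
  moreover have "range (\<lambda>n. Vertex (map w [0..<n])) \<subseteq> {\<gamma> \<in> tree. Ray w \<le> \<gamma>}"
    by (auto simp: tree_def)
  ultimately show ?thesis using finite_subset by blast
qed

lemma finite_ancestors_Vertex: "finite {\<gamma> \<in> tree. Vertex a \<le> \<gamma>}"
proof -
  have "{\<gamma> \<in> tree. Vertex a \<le> \<gamma>} = Vertex ` set (prefixes a)"
    by (auto simp: tree_def)
  then show ?thesis by simp
qed

lemma two_pow_minus_depth_strict_mono:
  assumes "x < y"
  shows "two_pow_minus (depth x) < two_pow_minus (depth y)"
proof -
  from assms obtain b where y: "y = Vertex b"
    by (cases x; cases y) (auto simp: less_le)
  show ?thesis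
  proof (cases x)
    case (Vertex a)
    have "x \<in> {\<gamma> \<in> tree. x \<le> \<gamma>}" "x \<notin> {\<gamma> \<in> tree. y \<le> \<gamma>}"
      using assms Vertex by (auto simp: tree_def)
    then have "{\<gamma> \<in> tree. y \<le> \<gamma>} \<subset> {\<gamma> \<in> tree. x \<le> \<gamma>}"
      using assms by force
    then have "card {\<gamma> \<in> tree. y \<le> \<gamma>} < card {\<gamma> \<in> tree. x \<le> \<gamma>}"
      using finite_ancestors_Vertex Vertex by (metis psubset_card_mono)
    then show ?thesis
      using y Vertex finite_ancestors_Vertex by (simp add: depth_def two_pow_minus_def)
  next
    case (Ray w)
    then show ?thesis
      using y finite_ancestors_Vertex infinite_ancestors_Ray
      by (simp add: depth_def two_pow_minus_def)
  qed
qed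

lemma two_pow_minus_depth_mono:
  "x \<le> y \<Longrightarrow> two_pow_minus (depth x) \<le> two_pow_minus (depth y)"
  by (metis le_less two_pow_minus_depth_strict_mono)

interpretation delta: Metric_space UNIV "delta :: ('d::finite \<Rightarrow> tbar) \<Rightarrow> ('d \<Rightarrow> tbar) \<Rightarrow> real"
proof
  let ?h = "\<lambda>x. two_pow_minus (depth x)"
  let ?e = "\<lambda>x y. ?h (sup x y) - 1/2 * (?h x + ?h y)"
  have ge: "?h x \<le> ?h (sup x y)" "?h y \<le> ?h (sup x y)" for x y :: tbar
    by (simp_all add: two_pow_minus_depth_mono)
  have nonneg: "0 \<le> ?e x y" for x y
    using ge[of x y] ge[of y x] by simp
  have zero: "?e x y = 0 \<longleftrightarrow> x = y" for x y
  proof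
    assume "?e x y = 0"
    then have "?h x = ?h (sup x y)" "?h y = ?h (sup x y)"
      using ge[of x y] ge[of y x] by simp_all
    then have "\<not> x < sup x y" "\<not> y < sup x y"
      using two_pow_minus_depth_strict_mono by (metis less_irrefl)+
    then show "x = y"
      by (metis le_less sup_ge1 sup_ge2)
  qed simp
  have tri: "?e x z \<le> ?e x y + ?e y z" for x y z :: tbar
  proof -
    have "?h (sup x z) + ?h y \<le> ?h (sup x y) + ?h (sup y z)"
    proof (cases "sup x y \<le> sup y z")
      case True
      then have "sup x z \<le> sup y z" by simp
      then show ?thesis
        using ge(2)[of y x] by (simp add: add_mono two_pow_minus_depth_mono ge add.commute)
    next
      case False
      then have "sup y z \<le> sup x y"
        using ancestors_chain[of y "sup x y" "sup y z"] by auto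
      then have "sup x z \<le> sup x y" by simp
      then show ?thesis
        by (simp add: add_mono two_pow_minus_depth_mono)
    qed
    then show ?thesis by (simp add: algebra_simps)
  qed
  fix x y z :: "'d \<Rightarrow> tbar"
  show "0 \<le> delta x y"
    unfolding delta_def by (rule sum_nonneg) (rule nonneg)
  show "delta x y = delta y x"
    unfolding delta_def by (simp add: sup_commute add.commute)
  show "delta x y = 0 \<longleftrightarrow> x = y"
    unfolding delta_def
    by (subst sum_nonneg_eq_0_iff) (simp_all only: finite nonneg zero fun_eq_iff UNIV_I ball_UNIV)
  show "delta x z \<le> delta x y + delta y z"
    unfolding delta_def sum.distrib[symmetric] by (rule sum_mono) (rule tri)
qed

text \<open>On \<open>polytree\<close>, the only place where the weight is used, every depth is finite.\<close>

definition poly_weight :: "('d::finite \<Rightarrow> real) \<Rightarrow> ('d \<Rightarrow> tbar) \<Rightarrow> real" where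
  "poly_weight s \<beta> = (\<Prod>j\<in>UNIV. 2 powr (s j * real (the_enat (depth (\<beta> j)))))"

text \<open>
  Sums are taken in the extended nonnegative reals, since both the potential at a boundary point
  and the energy may be infinite.
\<close>

definition potential ::
  "(('d::finite \<Rightarrow> tbar) \<Rightarrow> real) \<Rightarrow> (('d \<Rightarrow> tbar) \<Rightarrow> real) \<Rightarrow> ('d \<Rightarrow> tbar) \<Rightarrow> ennreal" where
  "potential \<pi> f \<alpha> = (\<Sum>\<^sub>\<infinity>\<gamma>\<in>{\<gamma> \<in> polytree. \<alpha> \<le> \<gamma>}. ennreal (f \<gamma> * \<pi> \<gamma>))"

definition energy :: "(('d::finite \<Rightarrow> tbar) \<Rightarrow> real) \<Rightarrow> (('d \<Rightarrow> tbar) \<Rightarrow> real) \<Rightarrow> ennreal" where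
  "energy \<pi> f = (\<Sum>\<^sub>\<infinity>\<alpha>\<in>polytree. ennreal ((f \<alpha>)\<^sup>2 * \<pi> \<alpha>))"

definition Cap :: "(('d::finite \<Rightarrow> tbar) \<Rightarrow> real) \<Rightarrow> ('d \<Rightarrow> tbar) set \<Rightarrow> ennreal" where
  "Cap \<pi> E = Inf {energy \<pi> f | f. (\<forall>\<alpha>\<in>polytree. 0 \<le> f \<alpha>) \<and> (\<forall>\<alpha>\<in>E. 1 \<le> potential \<pi> f \<alpha>)}"

end

(* Let f be admissible for the boundary projection of E. Averaging its potential over a uniformly
   random boundary point below beta, the summand at gamma is weighted by the probability that the
   point lies below gamma; this is the product over the coordinates of 2^-(d(gamma_j) - d(delta_j)),
   where delta is the least common ancestor of gamma and beta. The average is therefore at most the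
   potential at beta of

     g(delta) = pi(delta)^-1 * sum over gamma <= delta of
                  f(gamma) pi(gamma) prod_j 2^-(d(gamma_j) - d(delta_j)),

   so g is admissible for E. Since s_j < 1, the weight grows slower than the number 2^k of
   descendants at distance k, and a Schur test bounds the energy of g by a multiple of that of f. *)

theory Submission
  imports Defs "HOL-Probability.Probability"
begin

section \<open>Sums in the extended nonnegative reals as counting-measure integrals\<close>

text \<open>Makes Tonelli and Cauchy-Schwarz available for the sums that define potential and
  energy. For infinite \<open>A\<close> an enumeration reduces both sides to the same
  series.\<close>

lemma infsum_eq_nn_integral_count_space:
  fixes f :: "'a \<Rightarrow> ennreal"
  assumes "countable A"
  shows "infsum f A = (\<integral>\<^sup>+x. f x \<partial>count_space A)"
proof (cases "finite A")
  case True
  then show ?thesis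
    by (simp add: nn_integral_count_space_finite)
next
  case False
  have bij: "bij_betw (from_nat_into A) UNIV A"
    using assms False by (rule bij_betw_from_nat_into)
  have "((\<lambda>n. f (from_nat_into A n)) has_sum infsum (\<lambda>n. f (from_nat_into A n)) UNIV) UNIV"
    by (intro has_sum_infsum nonneg_summable_on_complete) simp
  then have "(\<lambda>n. f (from_nat_into A n)) sums infsum (\<lambda>n. f (from_nat_into A n)) UNIV"
    by (rule has_sum_imp_sums)
  then have "infsum (\<lambda>n. f (from_nat_into A n)) UNIV = (\<integral>\<^sup>+n. f (from_nat_into A n) \<partial>count_space UNIV)"
    by (simp add: nn_integral_count_space_nat sums_unique)
  then show ?thesis
    using infsum_reindex_bij_betw[OF bij, of f] nn_integral_bij_count_space[OF bij, of f] by simp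
qed

text \<open>A finite \<open>F\<close> lies in the box of its coordinate projections, over which the
  sum of products factors into a product of one-coordinate sums.\<close>

lemma nn_integral_count_space_prod_le:
  fixes h :: "'d::finite \<Rightarrow> 'a::countable \<Rightarrow> real"
  assumes nonneg: "\<And>j x. 0 \<le> h j x"
    and bound: "\<And>j F. finite F \<Longrightarrow> (\<Sum>x\<in>F. h j x) \<le> B j"
  shows "(\<integral>\<^sup>+c. ennreal (\<Prod>j\<in>UNIV. h j (c j)) \<partial>count_space UNIV) \<le> ennreal (\<Prod>j\<in>UNIV. B j)"
proof -
  have "(\<Sum>c\<in>F. ennreal (\<Prod>j\<in>UNIV. h j (c j))) \<le> ennreal (\<Prod>j\<in>UNIV. B j)" if "finite F" for F
  proof -
    let ?P = "PiE UNIV (\<lambda>j. (\<lambda>c. c j) ` F)"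
    have "(\<Sum>c\<in>F. \<Prod>j\<in>UNIV. h j (c j)) \<le> (\<Sum>c\<in>?P. \<Prod>j\<in>UNIV. h j (c j))"
      using that nonneg by (intro sum_mono2 finite_PiE) (auto intro: prod_nonneg)
    also have "\<dots> = (\<Prod>j\<in>UNIV. \<Sum>x\<in>(\<lambda>c. c j) ` F. h j x)"
      using that by (subst prod_sum_PiE) auto
    also have "\<dots> \<le> (\<Prod>j\<in>UNIV. B j)"
      using that nonneg by (intro prod_mono) (auto intro: sum_nonneg bound)
    finally show ?thesis
      by (subst sum_ennreal) (auto intro: prod_nonneg nonneg ennreal_leI)
  qed
  then show ?thesis
    by (subst infsum_eq_nn_integral_count_space[symmetric]) (auto intro!: infsum_le_finite_sums nonneg_summable_on_complete)
qed

section \<open>Geometric sums along the tree and the averaging kernel\<close>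

text \<open>There are 2^k words extending \<open>b\<close> by k letters, so a geometric series of
  ratio \<open>2 * r\<close> dominates.\<close>

lemma sum_power_extensions_le:
  fixes r :: real
  assumes r: "0 \<le> r" "2 * r < 1" and F: "finite F"
  shows "(\<Sum>c\<in>F. if prefix b (c :: bool list) then r ^ (length c - length b) else 0) \<le> 1 / (1 - 2 * r)"
proof -
  let ?S = "{c\<in>F. prefix b c}"
  \<comment> \<open>\<open>N\<close> exceeds every length in \<open>F\<close>, hence also the length
    of every remainder after \<open>b\<close> is stripped; \<open>insert 0\<close> covers empty
    \<open>F\<close>.\<close>
  define N where "N = Suc (Max (insert 0 (length ` F)))"
  have len: "length c < N" if "c \<in> F" for c
    unfolding N_def less_Suc_eq_le using F that by (intro Max_ge) auto
  have "(\<Sum>c\<in>F. if prefix b c then r ^ (length c - length b) else 0)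
      = (\<Sum>c\<in>?S. r ^ (length c - length b))"
    by (rule sum.inter_filter[OF F, symmetric])
  also have "\<dots> = (\<Sum>e\<in>drop (length b) ` ?S. r ^ length e)"
    by (subst sum.reindex) (auto simp: inj_on_def prefix_def)
  also have "\<dots> \<le> (\<Sum>e\<in>(\<Union>k<N. {e :: bool list. set e \<subseteq> UNIV \<and> length e = k}). r ^ length e)"
  proof (rule sum_mono2)
    show "finite (\<Union>k<N. {e :: bool list. set e \<subseteq> UNIV \<and> length e = k})"
      by (intro finite_UN_I finite_lists_length_eq) auto
    show "drop (length b) ` ?S \<subseteq> (\<Union>k<N. {e. set e \<subseteq> UNIV \<and> length e = k})"
      using len by (force intro: le_less_trans[rotated])
  qed (use r in auto)
  also have "\<dots> = (\<Sum>k<N. \<Sum>e\<in>{e :: bool list. set e \<subseteq> UNIV \<and> length e = k}. r ^ length e)"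
    by (intro sum.UNION_disjoint ballI finite_lists_length_eq) auto
  also have "\<dots> = (\<Sum>k<N. (2 * r) ^ k)"
  proof (rule sum.cong)
    fix k
    have "(\<Sum>e\<in>{e :: bool list. set e \<subseteq> UNIV \<and> length e = k}. r ^ length e)
        = (\<Sum>e\<in>{e :: bool list. set e \<subseteq> UNIV \<and> length e = k}. r ^ k)"
      by (rule sum.cong) auto
    then show "(\<Sum>e\<in>{e :: bool list. set e \<subseteq> UNIV \<and> length e = k}. r ^ length e) = (2 * r) ^ k"
      using card_lists_length_eq[of "UNIV :: bool set" k] by (simp add: power_mult_distrib)
  qed simp
  also have "\<dots> \<le> (\<Sum>k. (2 * r) ^ k)"
    using r by (intro sum_le_suminf summable_geometric) auto
  also have "\<dots> = 1 / (1 - 2 * r)"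
    using r by (intro suminf_geometric) auto
  finally show ?thesis .
qed

text \<open>A word has at most one prefix of each length, so there is no branching and the ratio is
  \<open>r\<close> itself.\<close>

lemma sum_power_prefixes_le:
  fixes r :: real
  assumes r: "0 \<le> r" "r < 1" and F: "finite F"
  shows "(\<Sum>b\<in>F. if prefix b c then r ^ (length c - length b) else 0) \<le> 1 / (1 - r)"
proof -
  let ?S = "{b\<in>F. prefix b c}"
  have inj: "inj_on (\<lambda>b. length c - length b) ?S"
  proof (rule inj_onI)
    fix a b assume "a \<in> ?S" "b \<in> ?S" "length c - length a = length c - length b"
    moreover from this have "length a = length b"
      using prefix_length_le[of a c] prefix_length_le[of b c] by auto
    ultimately show "a = b"
      by (auto simp: prefix_def append_eq_append_conv)
  qed
  have "(\<Sum>b\<in>F. if prefix b c then r ^ (length c - length b) else 0)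
      = (\<Sum>b\<in>?S. r ^ (length c - length b))"
    by (rule sum.inter_filter[OF F, symmetric])
  also have "\<dots> = (\<Sum>k\<in>(\<lambda>b. length c - length b) ` ?S. r ^ k)"
    by (simp add: sum.reindex[OF inj])
  also have "\<dots> \<le> (\<Sum>k. r ^ k)"
    using r F by (intro sum_le_suminf summable_geometric) auto
  also have "\<dots> = 1 / (1 - r)"
    using r by (intro suminf_geometric) auto
  finally show ?thesis .
qed

text \<open>With all rates 1/2 and \<open>b\<close> above \<open>c\<close>, this is the probability
  that a uniform boundary point below \<open>b\<close> lies below \<open>c\<close>. Other rates
  occur in the Schur test.\<close>

definition kernel :: "('d::finite \<Rightarrow> real) \<Rightarrow> ('d \<Rightarrow> bool list) \<Rightarrow> ('d \<Rightarrow> bool list) \<Rightarrow> real" where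
  "kernel r b c = (\<Prod>j\<in>UNIV. if prefix (b j) (c j) then r j ^ (length (c j) - length (b j)) else 0)"

lemma kernel_nonneg: "(\<And>j. 0 \<le> r j) \<Longrightarrow> 0 \<le> kernel r b c"
  unfolding kernel_def by (auto intro!: prod_nonneg)

lemma nn_integral_kernel_extensions_le:
  assumes "\<And>j. 0 \<le> r j" "\<And>j. 2 * r j < 1"
  shows "(\<integral>\<^sup>+c. ennreal (kernel r b c) \<partial>count_space UNIV) \<le> ennreal (\<Prod>j\<in>UNIV. 1 / (1 - 2 * r j))"
  unfolding kernel_def
  by (rule nn_integral_count_space_prod_le
      [where h = "\<lambda>j x. if prefix (b j) x then r j ^ (length x - length (b j)) else 0"])
    (use assms in \<open>auto intro!: sum_power_extensions_le\<close>)

lemma nn_integral_kernel_prefixes_le: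
  assumes "\<And>j. 0 \<le> r j" "\<And>j. r j < 1"
  shows "(\<integral>\<^sup>+b. ennreal (kernel r b c) \<partial>count_space UNIV) \<le> ennreal (\<Prod>j\<in>UNIV. 1 / (1 - r j))"
  unfolding kernel_def
  by (rule nn_integral_count_space_prod_le
      [where h = "\<lambda>j x. if prefix x (c j) then r j ^ (length (c j) - length x) else 0"])
    (use assms in \<open>auto intro!: sum_power_prefixes_le\<close>)

section \<open>Depth and weight of words\<close>

lemma depth_Vertex: "depth (Vertex a) = enat (Suc (length a))"
proof -
  have eq: "{\<gamma> \<in> tree. Vertex a \<le> \<gamma>} = Vertex ` set (prefixes a)"
    by (auto simp: tree_def)
  have "card (set (prefixes a)) = Suc (length a)"
    by (simp add: distinct_card)
  then have "card {\<gamma> \<in> tree. Vertex a \<le> \<gamma>} = Suc (length a)"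
    unfolding eq by (subst card_image) (auto simp: inj_on_def)
  then show ?thesis
    by (simp add: depth_def finite_ancestors_Vertex)
qed

lemma poly_weight_pos: "0 < poly_weight s \<beta>"
  unfolding poly_weight_def by (auto intro!: prod_pos)

lemma poly_weight_Vertex:
  "poly_weight s (Vertex \<circ> c) = (\<Prod>j\<in>UNIV. 2 powr (s j * real (Suc (length (c j)))))"
  by (simp add: poly_weight_def depth_Vertex)

text \<open>The factor \<open>q\<close> of the Schur test: half of the geometric decay of the weighted kernel is
  spent on each of the two sums.\<close>

lemma poly_weight_kernel_sq:
  fixes s :: "'d::finite \<Rightarrow> real" and b c :: "'d \<Rightarrow> bool list"
  defines "q \<equiv> \<lambda>j. 2 powr ((s j - 1) / 2)"
  shows "poly_weight s (Vertex \<circ> c) * (kernel (\<lambda>_. 1/2) b c)\<^sup>2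
    = poly_weight s (Vertex \<circ> b) * (kernel q b c * kernel (\<lambda>j. q j / 2) b c)"
proof -
  have *: "2 powr (s j * real (Suc (length (c j))))
      * (if prefix (b j) (c j) then (1/2) ^ (length (c j) - length (b j)) else 0 :: real)\<^sup>2
    = 2 powr (s j * real (Suc (length (b j))))
      * ((if prefix (b j) (c j) then q j ^ (length (c j) - length (b j)) else 0)
        * (if prefix (b j) (c j) then (q j / 2) ^ (length (c j) - length (b j)) else 0))" for j
  proof (cases "prefix (b j) (c j)")
    case True
    define n where "n = length (c j) - length (b j)"
    have len: "real (Suc (length (c j))) = real (Suc (length (b j))) + real n"
      using prefix_length_le[OF True] by (simp add: n_def)
    \<comment> \<open>One level further down multiplies the weight times the squared kernel by
      2^(s_j) / 4, which is \<open>q j * (q j / 2)\<close> because \<open>q j\<close> is the square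
      root of 2^(s_j - 1).\<close>
    have "q j * q j = 2 powr (s j - 1)"
      unfolding q_def powr_add[symmetric] by simp
    then have "q j * q j = 2 powr s j / 2"
      by (simp add: powr_diff)
    then have "2 powr s j * (1/2 * (1/2)) = q j * (q j / 2)"
      by simp
    then have "(2 powr s j) ^ n * ((1/2) ^ n)\<^sup>2 = q j ^ n * (q j / 2) ^ n"
      unfolding power2_eq_square power_mult_distrib[symmetric] by (rule arg_cong)
    moreover have "2 powr (s j * real n) = (2 powr s j) ^ n"
      by (simp add: powr_powr flip: powr_realpow)
    ultimately show ?thesis
      using True by (simp add: len distrib_left powr_add mult.assoc del: of_nat_Suc flip: n_def)
  qed simp
  show ?thesis
    unfolding poly_weight_Vertex kernel_def prod_power_distrib prod.distrib[symmetric] *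
    by simp
qed

section \<open>Energy and potential as sums over tuples of words\<close>

lemma polytree_eq: "(polytree :: ('d::finite \<Rightarrow> tbar) set) = range (\<lambda>c. Vertex \<circ> c)"
proof
  show "(polytree :: ('d \<Rightarrow> tbar) set) \<subseteq> range (\<lambda>c. Vertex \<circ> c)"
  proof
    fix \<gamma> :: "'d \<Rightarrow> tbar" assume "\<gamma> \<in> polytree"
    then have "\<forall>j. \<exists>c. \<gamma> j = Vertex c"
      by (auto simp: polytree_def tree_def)
    then obtain c where "\<And>j. \<gamma> j = Vertex (c j)" by metis
    then show "\<gamma> \<in> range (\<lambda>c. Vertex \<circ> c)" by (intro range_eqI[of _ _ c]) auto
  qed
qed (auto simp: polytree_def tree_def)

lemma inj_Vertex_comp: "inj_on (\<lambda>c. Vertex \<circ> c) A"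
  by (auto simp: inj_on_def fun_eq_iff)

lemma energy_eq_nn_integral:
  "energy \<pi> f = (\<integral>\<^sup>+c. ennreal ((f (Vertex \<circ> c))\<^sup>2 * \<pi> (Vertex \<circ> c)) \<partial>count_space UNIV)"
  unfolding energy_def polytree_eq infsum_reindex[OF inj_Vertex_comp]
  by (simp add: infsum_eq_nn_integral_count_space o_def)

lemma potential_eq_nn_integral:
  "potential \<pi> f \<alpha> = (\<integral>\<^sup>+c. ennreal (f (Vertex \<circ> c) * \<pi> (Vertex \<circ> c))
     * indicator {c. \<alpha> \<le> Vertex \<circ> c} c \<partial>count_space UNIV)"
proof -
  have eq: "{\<gamma> \<in> polytree. \<alpha> \<le> \<gamma>} = (\<lambda>c. Vertex \<circ> c) ` {c. \<alpha> \<le> Vertex \<circ> c}"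
    by (auto simp: polytree_eq)
  show ?thesis
    unfolding potential_def eq infsum_reindex[OF inj_Vertex_comp]
    by (simp add: infsum_eq_nn_integral_count_space o_def nn_integral_count_space_indicator)
qed

section \<open>The easy inequality\<close>

lemma potential_antimono: "\<alpha> \<le> \<beta> \<Longrightarrow> potential \<pi> f \<beta> \<le> potential \<pi> f \<alpha>"
  unfolding potential_eq_nn_integral
  by (intro nn_integral_mono mult_left_mono) (auto split: split_indicator)

text \<open>A point of \<open>bdry_proj E\<close> lies below a point of \<open>E\<close>, so all
  ancestors of the latter contribute to its potential; functions admissible for \<open>E\<close>
  stay admissible.\<close>

lemma Cap_bdry_proj_le: "Cap \<pi> (bdry_proj E) \<le> Cap \<pi> E"
  unfolding Cap_def
proof (rule Inf_superset_mono, safe)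
  fix f assume f: "\<forall>\<alpha>\<in>polytree. 0 \<le> f \<alpha>" "\<forall>\<alpha>\<in>E. 1 \<le> potential \<pi> f \<alpha>"
  have "\<forall>\<alpha>\<in>bdry_proj E. 1 \<le> potential \<pi> f \<alpha>"
  proof
    fix \<alpha> assume "\<alpha> \<in> bdry_proj E"
    then obtain \<beta> where "\<beta> \<in> E" "\<alpha> \<le> \<beta>"
      by (auto simp: bdry_proj_def bdry_succs_def succs_def)
    then show "1 \<le> potential \<pi> f \<alpha>"
      using f(2) potential_antimono[of \<alpha> \<beta> \<pi> f] by (metis order_trans)
  qed
  with f(1) show "\<exists>fa. energy \<pi> f = energy \<pi> fa \<and> (\<forall>\<alpha>\<in>polytree. 0 \<le> fa \<alpha>)
      \<and> (\<forall>\<alpha>\<in>bdry_proj E. 1 \<le> potential \<pi> fa \<alpha>)"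
    by blast
qed

section \<open>Random boundary points below a given point\<close>

text \<open>Independent fair bits \<open>x\<close> turn this into a uniform boundary point below a
  vertex. Bits are indexed by absolute position, those before \<open>length a\<close> being
  overridden by \<open>a\<close>; the only boundary point below a ray is the ray itself.\<close>

fun ray_below :: "tbar \<Rightarrow> (nat \<Rightarrow> bool) \<Rightarrow> tbar" where
  "ray_below (Vertex a) x = Ray (\<lambda>n. if n < length a then a ! n else x n)"
| "ray_below (Ray w) x = Ray w"

lemma ray_below_in_bdry: "ray_below \<beta> x \<in> bdry"
  by (cases \<beta>) (auto simp: bdry_def)

lemma ray_below_le: "ray_below \<beta> x \<le> \<beta>"
proof (cases \<beta>)
  case (Vertex a)
  then have "a = map (\<lambda>n. if n < length a then a ! n else x n) [0..<length a]"
    by (auto intro: nth_equalityI)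
  then show ?thesis
    unfolding Vertex ray_below.simps less_eq_tbar.simps by (rule exI)
qed simp

text \<open>The ray lies below both \<open>\<beta>\<close> and \<open>c\<close>, so these are
  comparable and \<open>d\<close> is the one nearer the root. Only the bits between \<open>d\<close>
  and \<open>c\<close> are constrained. The clause with \<open>sup\<close> shows that
  \<open>d\<close> does not depend on \<open>x\<close>.\<close>

lemma ray_below_le_VertexD:
  assumes "ray_below \<beta> x \<le> Vertex c"
  obtains d where "\<beta> \<le> Vertex d" "prefix d c" "sup \<beta> (Vertex c) = Vertex d"
    "\<forall>n\<in>{length d..<length c}. x n = c ! n"
proof (cases \<beta>)
  case (Ray w)
  then have "\<beta> \<le> Vertex c" using assms by simp
  then show ?thesis using that[of c] by (simp add: sup_absorb2)
next
  case (Vertex a)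
  from assms Vertex obtain m where
    c: "c = map (\<lambda>n. if n < length a then a ! n else x n) [0..<m]"
    by auto
  have "\<beta> \<le> Vertex c \<or> Vertex c \<le> \<beta>"
    using ancestors_chain[OF assms ray_below_le] by blast
  then show ?thesis
  proof
    assume "\<beta> \<le> Vertex c"
    then show ?thesis using that[of c] by (simp add: sup_absorb2)
  next
    assume le: "Vertex c \<le> \<beta>"
    then show ?thesis using that[of a] Vertex c by (auto simp: sup_absorb1)
  qed
qed

text \<open>With \<open>u\<close> equal to f times the weight, the inner integral is g times the
  weight, so admissibility passes from the boundary below \<open>\<beta>\<close> to
  \<open>\<beta>\<close> itself.\<close>

lemma nn_integral_kernel_ge_one:
  fixes \<beta> :: "'d::finite \<Rightarrow> tbar" and u :: "('d \<Rightarrow> bool list) \<Rightarrow> ennreal"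
  assumes ge: "\<And>\<omega>. \<omega> \<in> bdry_succs \<beta> \<Longrightarrow>
    1 \<le> (\<integral>\<^sup>+c. u c * indicator {c. \<omega> \<le> Vertex \<circ> c} c \<partial>count_space UNIV)"
  shows "1 \<le> (\<integral>\<^sup>+b. (\<integral>\<^sup>+c. u c * ennreal (kernel (\<lambda>_. 1/2) b c) \<partial>count_space UNIV)
    * indicator {b. \<beta> \<le> Vertex \<circ> b} b \<partial>count_space UNIV)"
proof -
  \<comment> \<open>One fair coin for each pair of a coordinate and a position.\<close>
  define M where "M = PiM (UNIV :: ('d \<times> nat) set) (\<lambda>_. uniform_count_measure (UNIV :: bool set))"
  interpret product_prob_space "\<lambda>_ :: 'd \<times> nat. uniform_count_measure (UNIV :: bool set)" UNIV
    by (intro product_prob_spaceI prob_space_uniform_count_measure) auto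
  define \<omega> where "\<omega> x = (\<lambda>j. ray_below (\<beta> j) (\<lambda>n. x (j, n)))" for x
  define K where "K c = (\<integral>\<^sup>+b. ennreal (kernel (\<lambda>_. 1/2) b c)
    * indicator {b. \<beta> \<le> Vertex \<circ> b} b \<partial>count_space UNIV)" for c
  \<comment> \<open>Only an upper bound for the probability enters later, so it is enough to enclose
    the event in a measurable cylinder.\<close>
  have cyl: "\<exists>A\<in>sets M. {x. \<omega> x \<le> Vertex \<circ> c} \<subseteq> A \<and> emeasure M A \<le> K c" for c
  proof (cases "\<exists>x. \<omega> x \<le> Vertex \<circ> c")
    case True
    then obtain y where y: "\<omega> y \<le> Vertex \<circ> c" ..
    have "\<exists>d. \<beta> j \<le> Vertex d \<and> prefix d (c j) \<and> sup (\<beta> j) (Vertex (c j)) = Vertex d" for j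
    proof -
      have "ray_below (\<beta> j) (\<lambda>n. y (j, n)) \<le> Vertex (c j)"
        using y by (auto simp: \<omega>_def le_fun_def)
      then show ?thesis by (rule ray_below_le_VertexD) blast
    qed
    then obtain d where d: "\<And>j. \<beta> j \<le> Vertex (d j)" "\<And>j. prefix (d j) (c j)"
      "\<And>j. sup (\<beta> j) (Vertex (c j)) = Vertex (d j)"
      by metis
    \<comment> \<open>\<open>J\<close> collects the bits between the least common ancestor
      \<open>d\<close> and \<open>c\<close>; prescribing them has probability 2^(- card J), which is
      the kernel at \<open>d\<close> and \<open>c\<close>.\<close>
    define J where "J = (SIGMA j:UNIV. {length (d j)..<length (c j)})"
    define A where "A = prod_emb UNIV (\<lambda>_. uniform_count_measure UNIV) J (PiE J (\<lambda>(j, n). {c j ! n}))"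
    have fin: "finite J" by (auto simp: J_def)
    have "A \<in> sets M"
      unfolding A_def M_def using fin by (intro sets_PiM_I) auto
    moreover have "{x. \<omega> x \<le> Vertex \<circ> c} \<subseteq> A"
    proof
      fix x assume "x \<in> {x. \<omega> x \<le> Vertex \<circ> c}"
      then have le: "ray_below (\<beta> j) (\<lambda>n. x (j, n)) \<le> Vertex (c j)" for j
        by (auto simp: \<omega>_def le_fun_def)
      \<comment> \<open>The ancestor obtained for \<open>x\<close> is the \<open>d\<close> chosen
        from \<open>y\<close>, as both equal the same \<open>sup\<close>.\<close>
      have "x (j, n) = c j ! n" if "n \<in> {length (d j)..<length (c j)}" for j n
        using le[of j] d(3)[of j] that by (elim ray_below_le_VertexD) auto
      then show "x \<in> A"
        by (auto simp: A_def prod_emb_def J_def space_uniform_count_measure)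
    qed
    moreover have "emeasure M A \<le> K c"
    proof -
      have "emeasure M A = (\<Prod>p\<in>J. emeasure (uniform_count_measure UNIV) (case p of (j, n) \<Rightarrow> {c j ! n}))"
        unfolding M_def A_def using fin by (intro emeasure_PiM_emb) auto
      also have "\<dots> = (\<Prod>p\<in>J. ennreal (1/2))"
        by (rule prod.cong) (auto simp: emeasure_uniform_count_measure)
      also have "\<dots> = ennreal ((1/2) ^ card J)"
        by (simp only: prod_constant) (rule ennreal_power, simp)
      also have "(1/2 :: real) ^ card J = kernel (\<lambda>_. 1/2) d c"
        using d(2) by (simp add: J_def card_SigmaI kernel_def power_sum)
      also have "ennreal (kernel (\<lambda>_. 1/2) d c)
          = (\<integral>\<^sup>+b. ennreal (kernel (\<lambda>_. 1/2) b c) * indicator {d} b \<partial>count_space UNIV)"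
        by (simp add: nn_integral_indicator_singleton')
      \<comment> \<open>\<open>d\<close> lies above \<open>\<beta>\<close>, so its term is one of
        the nonnegative terms summed in \<open>K c\<close>.\<close>
      also have "\<dots> \<le> K c"
        unfolding K_def using d(1) by (intro nn_integral_mono mult_left_mono)
          (auto simp: le_fun_def split: split_indicator)
      finally show ?thesis .
    qed
    ultimately show ?thesis by blast
  next
    case False
    then show ?thesis by (intro bexI[of _ "{}"]) auto
  qed
  then obtain A where A: "\<And>c. A c \<in> sets M" "\<And>c. {x. \<omega> x \<le> Vertex \<circ> c} \<subseteq> A c"
    "\<And>c. emeasure M (A c) \<le> K c"
    by metis
  note [measurable] = A(1)
  \<comment> \<open>The boundary inequality is averaged over \<open>M\<close>, and Tonelli moves the
    average onto each term.\<close>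
  have "1 = emeasure M (space M)"
    unfolding M_def by (rule P.emeasure_space_1[symmetric])
  also have "\<dots> = (\<integral>\<^sup>+x. 1 \<partial>M)"
    by simp
  also have "\<dots> \<le> (\<integral>\<^sup>+x. \<integral>\<^sup>+c. u c * indicator (A c) x \<partial>count_space UNIV \<partial>M)"
  proof (rule nn_integral_mono)
    fix x
    have "\<omega> x \<in> bdry_succs \<beta>"
      by (auto simp: bdry_succs_def succs_def polybdry_def \<omega>_def le_fun_def
          ray_below_in_bdry ray_below_le)
    then have "1 \<le> (\<integral>\<^sup>+c. u c * indicator {c. \<omega> x \<le> Vertex \<circ> c} c \<partial>count_space UNIV)"
      by (rule ge)
    also have "\<dots> \<le> (\<integral>\<^sup>+c. u c * indicator (A c) x \<partial>count_space UNIV)"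
      using A(2) by (intro nn_integral_mono mult_left_mono) (auto split: split_indicator)
    finally show "1 \<le> (\<integral>\<^sup>+c. u c * indicator (A c) x \<partial>count_space UNIV)" .
  qed
  also have "\<dots> = (\<integral>\<^sup>+c. \<integral>\<^sup>+x. u c * indicator (A c) x \<partial>M \<partial>count_space UNIV)"
    by (rule nn_integral_count_space_nn_integral) auto
  also have "\<dots> = (\<integral>\<^sup>+c. u c * emeasure M (A c) \<partial>count_space UNIV)"
    by (simp add: nn_integral_cmult)
  also have "\<dots> \<le> (\<integral>\<^sup>+c. u c * K c \<partial>count_space UNIV)"
    by (intro nn_integral_mono mult_left_mono A) auto
  also have "\<dots> = (\<integral>\<^sup>+c. \<integral>\<^sup>+b. u c * ennreal (kernel (\<lambda>_. 1/2) b c)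
      * indicator {b. \<beta> \<le> Vertex \<circ> b} b \<partial>count_space UNIV \<partial>count_space UNIV)"
    by (simp add: K_def nn_integral_cmult[symmetric] mult.assoc)
  also have "\<dots> = (\<integral>\<^sup>+b. \<integral>\<^sup>+c. u c * ennreal (kernel (\<lambda>_. 1/2) b c)
      * indicator {b. \<beta> \<le> Vertex \<circ> b} b \<partial>count_space UNIV \<partial>count_space UNIV)"
    by (rule nn_integral_count_space_nn_integral) auto
  also have "\<dots> = (\<integral>\<^sup>+b. (\<integral>\<^sup>+c. u c * ennreal (kernel (\<lambda>_. 1/2) b c) \<partial>count_space UNIV)
      * indicator {b. \<beta> \<le> Vertex \<circ> b} b \<partial>count_space UNIV)"
    by (simp add: nn_integral_multc)
  finally show ?thesis .
qed

section \<open>The Schur test\<close>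

text \<open>Cauchy-Schwarz in \<open>c\<close> for fixed \<open>b\<close>, with the weighted squared
  kernel split into \<open>A\<close> and \<open>B\<close>. Summing \<open>B\<close> over descendants
  and then \<open>A\<close> over ancestors costs one factor \<open>K\<close> each. The factor
  \<open>1 / W b\<close> appears because g is the inner integral divided by the weight.\<close>

lemma kernel_energy_le:
  fixes s :: "'d::finite \<Rightarrow> real" and v :: "('d \<Rightarrow> bool list) \<Rightarrow> real"
  defines "q \<equiv> \<lambda>j. 2 powr ((s j - 1) / 2)" and "W \<equiv> \<lambda>c. poly_weight s (Vertex \<circ> c)"
  assumes s: "\<And>j. s j < 1" and v: "\<And>c. 0 \<le> v c"
  shows "(\<integral>\<^sup>+b. (\<integral>\<^sup>+c. ennreal (v c * W c) * ennreal (kernel (\<lambda>_. 1/2) b c) \<partial>count_space UNIV)\<^sup>2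
      * ennreal (1 / W b) \<partial>count_space UNIV)
    \<le> ennreal ((\<Prod>j\<in>UNIV. 1 / (1 - q j))\<^sup>2) * (\<integral>\<^sup>+c. ennreal ((v c)\<^sup>2 * W c) \<partial>count_space UNIV)"
proof -
  define K where "K = (\<Prod>j\<in>UNIV. 1 / (1 - q j))"
  define k where "k b c = kernel (\<lambda>_. 1/2) b c" for b c :: "'d \<Rightarrow> bool list"
  define A where "A b c = kernel q b c" for b c
  define B where "B b c = kernel (\<lambda>j. q j / 2) b c" for b c
  define e where "e b = (\<integral>\<^sup>+c. ennreal ((v c)\<^sup>2 * W c) * ennreal (A b c) \<partial>count_space UNIV)" for b
  have W: "0 < W c" for c
    unfolding W_def by (rule poly_weight_pos)
  \<comment> \<open>Here s_j < 1 enters: it makes both geometric series converge.\<close>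
  have "q j < 2 powr 0" for j
    unfolding q_def using s[of j] by (intro powr_less_mono) auto
  then have q: "0 \<le> q j" "q j < 1" for j
    by (simp_all add: q_def)
  have K: "0 \<le> K"
    unfolding K_def using q by (auto intro!: prod_nonneg simp: less_imp_le)
  have nonneg: "0 \<le> k b c" "0 \<le> A b c" "0 \<le> B b c" for b c
    using q by (auto simp: k_def A_def B_def intro!: kernel_nonneg)
  have factor: "W c * (k b c)\<^sup>2 = W b * (A b c * B b c)" for b c
    unfolding W_def k_def A_def B_def q_def by (rule poly_weight_kernel_sq)
  have A_int: "(\<integral>\<^sup>+b. ennreal (A b c) \<partial>count_space UNIV) \<le> ennreal K" for c
    unfolding A_def K_def using q by (intro nn_integral_kernel_prefixes_le)
  \<comment> \<open>The rate \<open>q j / 2\<close> offsets the branching, since 1 - 2 (q_j / 2) = 1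
    - q_j; hence the same bound \<open>K\<close> as for \<open>A\<close>.\<close>
  have B_int: "(\<integral>\<^sup>+c. ennreal (B b c) \<partial>count_space UNIV) \<le> ennreal K" for b
    using nn_integral_kernel_extensions_le[of "\<lambda>j. q j / 2" b] q by (simp add: B_def K_def)
  have CS: "(\<integral>\<^sup>+c. ennreal (v c * W c) * ennreal (k b c) \<partial>count_space UNIV)\<^sup>2 * ennreal (1 / W b)
      \<le> e b * ennreal K" for b
  proof -
    \<comment> \<open>By \<open>factor\<close>, the product of the two radicands is the square of
      the left-hand term.\<close>
    have split: "ennreal (v c * W c) * ennreal (k b c)
        = ennreal (sqrt ((v c)\<^sup>2 * W c * A b c)) * ennreal (sqrt (W b * B b c))" for c
    proof -
      have "((v c)\<^sup>2 * W c * A b c) * (W b * B b c) = (v c)\<^sup>2 * W c * (W b * (A b c * B b c))"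
        by (simp add: mult_ac)
      also have "\<dots> = (v c * W c * k b c)\<^sup>2"
        by (simp add: factor[symmetric] power2_eq_square mult_ac)
      finally have "sqrt ((v c)\<^sup>2 * W c * A b c) * sqrt (W b * B b c) = v c * W c * k b c"
        using v[of c] W[of c] nonneg(1)[of b c] by (simp add: abs_of_nonneg less_imp_le flip: real_sqrt_mult)
      then show ?thesis
        using v[of c] W[of c] W[of b] nonneg[of b c] by (simp add: ennreal_mult[symmetric])
    qed
    have "(\<integral>\<^sup>+c. ennreal (v c * W c) * ennreal (k b c) \<partial>count_space UNIV)\<^sup>2
        \<le> (\<integral>\<^sup>+c. (ennreal (sqrt ((v c)\<^sup>2 * W c * A b c)))\<^sup>2 \<partial>count_space UNIV)
          * (\<integral>\<^sup>+c. (ennreal (sqrt (W b * B b c)))\<^sup>2 \<partial>count_space UNIV)"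
      unfolding split by (rule Cauchy_Schwarz_nn_integral) auto
    also have "(\<integral>\<^sup>+c. (ennreal (sqrt ((v c)\<^sup>2 * W c * A b c)))\<^sup>2 \<partial>count_space UNIV) = e b"
      unfolding e_def using W nonneg
      by (intro nn_integral_cong) (simp add: ennreal_power ennreal_mult[symmetric] less_imp_le)
    also have "(\<integral>\<^sup>+c. (ennreal (sqrt (W b * B b c)))\<^sup>2 \<partial>count_space UNIV)
        = ennreal (W b) * (\<integral>\<^sup>+c. ennreal (B b c) \<partial>count_space UNIV)"
      using W nonneg by (subst nn_integral_cmult[symmetric])
        (auto intro!: nn_integral_cong simp: ennreal_power ennreal_mult[symmetric] less_imp_le)
    also have "e b * \<dots> \<le> e b * (ennreal (W b) * ennreal K)"
      by (intro mult_left_mono B_int) auto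
    finally have "(\<integral>\<^sup>+c. ennreal (v c * W c) * ennreal (k b c) \<partial>count_space UNIV)\<^sup>2 * ennreal (1 / W b)
        \<le> e b * (ennreal (W b) * ennreal K) * ennreal (1 / W b)"
      by (rule mult_right_mono) simp
    also have "\<dots> = e b * ennreal K * (ennreal (W b) * ennreal (1 / W b))"
      by (simp add: mult_ac)
    also have "ennreal (W b) * ennreal (1 / W b) = 1"
      using W[of b] by (simp add: ennreal_mult[symmetric])
    finally show ?thesis by simp
  qed
  \<comment> \<open>After exchanging the order, the sum of \<open>A\<close> over the ancestors
    \<open>b\<close> of each \<open>c\<close> is bounded by \<open>K\<close>.\<close>
  have "(\<integral>\<^sup>+b. e b \<partial>count_space UNIV)
      = (\<integral>\<^sup>+c. \<integral>\<^sup>+b. ennreal ((v c)\<^sup>2 * W c) * ennreal (A b c) \<partial>count_space UNIV \<partial>count_space UNIV)"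
    unfolding e_def by (rule nn_integral_count_space_nn_integral) auto
  also have "\<dots> = (\<integral>\<^sup>+c. ennreal ((v c)\<^sup>2 * W c)
      * (\<integral>\<^sup>+b. ennreal (A b c) \<partial>count_space UNIV) \<partial>count_space UNIV)"
    by (simp add: nn_integral_cmult)
  also have "\<dots> \<le> (\<integral>\<^sup>+c. ennreal ((v c)\<^sup>2 * W c) * ennreal K \<partial>count_space UNIV)"
    by (intro nn_integral_mono mult_left_mono A_int) auto
  also have "\<dots> = (\<integral>\<^sup>+c. ennreal ((v c)\<^sup>2 * W c) \<partial>count_space UNIV) * ennreal K"
    by (rule nn_integral_multc) simp
  finally have e_int: "(\<integral>\<^sup>+b. e b \<partial>count_space UNIV)
    \<le> (\<integral>\<^sup>+c. ennreal ((v c)\<^sup>2 * W c) \<partial>count_space UNIV) * ennreal K" .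
  have "(\<integral>\<^sup>+b. (\<integral>\<^sup>+c. ennreal (v c * W c) * ennreal (k b c) \<partial>count_space UNIV)\<^sup>2
      * ennreal (1 / W b) \<partial>count_space UNIV) \<le> (\<integral>\<^sup>+b. e b * ennreal K \<partial>count_space UNIV)"
    by (intro nn_integral_mono CS)
  also have "\<dots> = (\<integral>\<^sup>+b. e b \<partial>count_space UNIV) * ennreal K"
    by (rule nn_integral_multc) simp
  also have "\<dots> \<le> (\<integral>\<^sup>+c. ennreal ((v c)\<^sup>2 * W c) \<partial>count_space UNIV) * ennreal K * ennreal K"
    by (intro mult_right_mono e_int) simp
  also have "\<dots> = ennreal (K\<^sup>2) * (\<integral>\<^sup>+c. ennreal ((v c)\<^sup>2 * W c) \<partial>count_space UNIV)"
    by (simp add: power2_eq_square ennreal_mult[OF K K] mult_ac)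
  finally show ?thesis
    unfolding k_def K_def .
qed

section \<open>The reverse inequality\<close>

lemma Cap_le_nn_integral:
  fixes u :: "('d::finite \<Rightarrow> bool list) \<Rightarrow> real"
  assumes "\<And>b. 0 \<le> u b"
    and "\<And>\<beta>. \<beta> \<in> E \<Longrightarrow> 1 \<le> (\<integral>\<^sup>+b. ennreal (u b * \<pi> (Vertex \<circ> b))
      * indicator {b. \<beta> \<le> Vertex \<circ> b} b \<partial>count_space UNIV)"
  shows "Cap \<pi> E \<le> (\<integral>\<^sup>+b. ennreal ((u b)\<^sup>2 * \<pi> (Vertex \<circ> b)) \<partial>count_space UNIV)"
proof -
  \<comment> \<open>\<open>inv\<close> recovers the words on \<open>polytree\<close>; its arbitrary
    values elsewhere do not enter energy or potential.\<close>
  let ?f = "\<lambda>\<gamma>. u (inv (\<lambda>c. Vertex \<circ> c) \<gamma>)"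
  have inv: "inv (\<lambda>c. Vertex \<circ> c) (Vertex \<circ> b) = b" for b :: "'d \<Rightarrow> bool list"
    by (rule inv_f_f[OF inj_Vertex_comp])
  have "Cap \<pi> E \<le> energy \<pi> ?f"
    unfolding Cap_def
    by (rule Inf_lower) (use assms in \<open>auto simp: potential_eq_nn_integral inv\<close>)
  then show ?thesis
    by (simp add: energy_eq_nn_integral inv)
qed

lemma Cap_le_energy_of_bdry_proj:
  fixes s :: "'d::finite \<Rightarrow> real"
  defines "K \<equiv> \<Prod>j\<in>UNIV. 1 / (1 - 2 powr ((s j - 1) / 2))"
  assumes s: "\<And>j. s j < 1" and f: "\<forall>\<alpha>\<in>polytree. 0 \<le> f \<alpha>"
    and pot: "\<forall>\<alpha>\<in>bdry_proj E. 1 \<le> potential (poly_weight s) f \<alpha>"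
  shows "Cap (poly_weight s) E \<le> ennreal (1 + K\<^sup>2) * energy (poly_weight s) f"
\<comment> \<open>The competitor must be real-valued, so infinite energy is split off; the right
  side is then infinite since \<open>1 + K\<^sup>2\<close> is positive.\<close>
proof (cases "energy (poly_weight s) f = \<infinity>")
  case True
  then show ?thesis by (simp add: ennreal_mult_top add_pos_nonneg)
next
  case False
  define v where "v c = f (Vertex \<circ> c)" for c
  define W where "W c = poly_weight s (Vertex \<circ> c)" for c
  define G where "G b = (\<integral>\<^sup>+c. ennreal (v c * W c) * ennreal (kernel (\<lambda>_. 1/2) b c) \<partial>count_space UNIV)" for b
  have W: "0 < W c" for c
    unfolding W_def by (rule poly_weight_pos)
  have "0 \<le> v c" for c
    using f by (auto simp: v_def polytree_eq)
  then have le: "(\<integral>\<^sup>+b. (G b)\<^sup>2 * ennreal (1 / W b) \<partial>count_space UNIV)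
      \<le> ennreal (K\<^sup>2) * energy (poly_weight s) f"
    unfolding G_def W_def K_def energy_eq_nn_integral v_def[symmetric]
    by (intro kernel_energy_le s)
  \<comment> \<open>A single infinite \<open>G b\<close> would make the Schur sum infinite, although
    finite energy bounds it.\<close>
  have G: "G b \<noteq> \<infinity>" for b
  proof
    assume "G b = \<infinity>"
    then have "(G b)\<^sup>2 * ennreal (1 / W b) = \<infinity>"
      using W[of b] by (simp add: power2_eq_square ennreal_top_mult)
    moreover have "(G b)\<^sup>2 * ennreal (1 / W b) \<le> (\<integral>\<^sup>+b. (G b)\<^sup>2 * ennreal (1 / W b) \<partial>count_space UNIV)"
      by (rule nn_integral_ge_point) simp
    ultimately have "ennreal (K\<^sup>2) * energy (poly_weight s) f = \<infinity>"
      using le by (simp add: top_unique)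
    with False show False
      by (simp add: ennreal_mult_eq_top_iff)
  qed
  \<comment> \<open>This is the function g; finiteness of \<open>G b\<close> makes
    \<open>enn2real\<close> lossless.\<close>
  define u where "u b = enn2real (G b) / W b" for b
  have u_W: "ennreal (u b * W b) = G b" for b
    using W[of b] G[of b] by (simp add: u_def ennreal_enn2real_if)
  have u_nonneg: "0 \<le> u b" for b
    using W[of b] by (simp add: u_def)
  have u_sq: "ennreal ((u b)\<^sup>2 * W b) = (G b)\<^sup>2 * ennreal (1 / W b)" for b
  proof -
    have "(u b)\<^sup>2 * W b = (u b * W b)\<^sup>2 * (1 / W b)"
      using W[of b] by (simp add: power2_eq_square)
    then show ?thesis
      using W[of b] by (simp only: ennreal_mult zero_le_power2 zero_le_divide_1_iff less_imp_le)
        (simp add: u_W u_nonneg less_imp_le flip: ennreal_power)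
  qed
  have "Cap (poly_weight s) E \<le> (\<integral>\<^sup>+b. ennreal ((u b)\<^sup>2 * poly_weight s (Vertex \<circ> b)) \<partial>count_space UNIV)"
  proof (rule Cap_le_nn_integral)
    show "0 \<le> u b" for b
      by (rule u_nonneg)
    fix \<beta> assume "\<beta> \<in> E"
    then have "1 \<le> (\<integral>\<^sup>+c. ennreal (v c * W c) * indicator {c. \<omega> \<le> Vertex \<circ> c} c \<partial>count_space UNIV)"
      if "\<omega> \<in> bdry_succs \<beta>" for \<omega>
      using pot that by (auto simp: bdry_proj_def potential_eq_nn_integral v_def W_def)
    then show "1 \<le> (\<integral>\<^sup>+b. ennreal (u b * poly_weight s (Vertex \<circ> b))
        * indicator {b. \<beta> \<le> Vertex \<circ> b} b \<partial>count_space UNIV)"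
      unfolding W_def[symmetric] u_W G_def by (rule nn_integral_kernel_ge_one)
  qed
  also have "\<dots> \<le> ennreal (K\<^sup>2) * energy (poly_weight s) f"
    unfolding W_def[symmetric] u_sq by (rule le)
  also have "\<dots> \<le> ennreal (1 + K\<^sup>2) * energy (poly_weight s) f"
    by (intro mult_right_mono ennreal_leI) auto
  finally show ?thesis .
qed

theorem corollary3p1:
  fixes s :: "'d::finite \<Rightarrow> real"
  assumes "\<And>j. 0 \<le> s j \<and> s j < 1"
  shows "\<exists>C::real. C > 1 \<and>
    (\<forall>E :: ('d \<Rightarrow> tbar) set. compactin delta.mtopology E \<longrightarrow>
      Cap (poly_weight s) (bdry_proj E) \<le> Cap (poly_weight s) E \<and>
      Cap (poly_weight s) E \<le> ennreal C * Cap (poly_weight s) (bdry_proj E))"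
proof -
  define K where "K = (\<Prod>j\<in>UNIV. 1 / (1 - 2 powr ((s j - 1) / 2)))"
  have "1 - 2 powr ((s j - 1) / 2) \<noteq> 0" for j
    using assms[of j] by simp
  then have "K \<noteq> 0"
    by (simp add: K_def)
  \<comment> \<open>The Schur bound is \<open>K\<^sup>2\<close>; adding 1 gives the strict
    inequality at once.\<close>
  then have C: "1 + K\<^sup>2 > 1"
    by simp
  have "Cap (poly_weight s) E \<le> ennreal (1 + K\<^sup>2) * Cap (poly_weight s) (bdry_proj E)" for E
  proof -
    \<comment> \<open>Dividing by the constant leaves a quantity below the energy of every
      admissible f, hence below the infimum.\<close>
    have "Cap (poly_weight s) E / ennreal (1 + K\<^sup>2) \<le> Cap (poly_weight s) (bdry_proj E)"
      unfolding Cap_def[of _ "bdry_proj E"]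
    proof (rule Inf_greatest, safe)
      fix f assume "\<forall>\<alpha>\<in>polytree. 0 \<le> f \<alpha>" "\<forall>\<alpha>\<in>bdry_proj E. 1 \<le> potential (poly_weight s) f \<alpha>"
      then have "Cap (poly_weight s) E \<le> ennreal (1 + K\<^sup>2) * energy (poly_weight s) f"
        unfolding K_def using assms by (intro Cap_le_energy_of_bdry_proj) auto
      then show "Cap (poly_weight s) E / ennreal (1 + K\<^sup>2) \<le> energy (poly_weight s) f"
        by (intro divide_le_posI_ennreal) (auto simp: add_pos_nonneg)
    qed
    then have "ennreal (1 + K\<^sup>2) * (Cap (poly_weight s) E / ennreal (1 + K\<^sup>2))
        \<le> ennreal (1 + K\<^sup>2) * Cap (poly_weight s) (bdry_proj E)"
      by (rule mult_left_mono) simp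
    moreover have "ennreal (1 + K\<^sup>2) * (Cap (poly_weight s) E / ennreal (1 + K\<^sup>2))
        = Cap (poly_weight s) E"
      unfolding ennreal_times_divide by (subst mult.commute, rule ennreal_mult_divide_eq) (use C in auto)
    ultimately show ?thesis by simp
  qed
  then show ?thesis
    using C Cap_bdry_proj_le by (intro exI[of _ "1 + K\<^sup>2"]) auto
qed

end
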